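(* Let $m \geq 2$ and let $\mathcal{A}_1,\ldots,\mathcal{A}_m \subseteq \mathbb{N}$ form an $m$-family of direct factors of $\mathbb{N}$. Then for each $1 \leq i \leq m$, the set $\mathcal{A}_i$ has natural density, and \[ d\mathcal{A}_i = \prod_{\substack{j=1 \\ j \neq i}}^{m} H(\mathcal{A}_j)^{-1}, \] where the right-hand side is interpreted as $0$ if $H(\mathcal{A}_j) = \infty$ for some $j \neq i$.
   Context: $\mathbb{N}$ denotes the positive integers. A family $\{\mathcal{A}_1,\ldots,\mathcal{A}_m\}$ of subsets of $\mathbb{N}$ is an $m$-family of direct factors of $\mathbb{N}$ if for each $n \in \mathbb{N}$ there is a unique $m$-tuple $(a_1,\ldots,a_m) \in \mathcal{A}_1 \times \cdots \times \mathcal{A}_m$ with $n = a_1 \cdots a_m$. For $\mathcal{S} \subseteq \mathbb{N}$, $H(\mathcal{S}) := \sum_{s \in \mathcal{S}} 1/s \in [0,\infty]$ is its harmonic sum. A set $\mathcal{S}$ has natural density if $\lim_{x\to\infty} x^{-1}\#\{n \le x : n \in \mathcal{S}\}$ exists; this limit is denoted $d\mathcal{S}$. *)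

theory Defs
  imports "HOL-Analysis.Analysis"
begin

text \<open>
  The sets under consideration consist of positive integers; they are modelled as sets of
  type \<open>nat set\<close> that do not contain 0. An \<open>m\<close>-family is indexed by \<open>{1..m}\<close>, and an
  \<open>m\<close>-tuple is an extensional function on \<open>{1..m}\<close>, so that uniqueness of the tuple is
  uniqueness of the function.
\<close>

definition direct_factors :: "nat \<Rightarrow> (nat \<Rightarrow> nat set) \<Rightarrow> bool" where
  "direct_factors m A \<longleftrightarrow>
     (\<forall>i\<in>{1..m}. A i \<subseteq> {1..}) \<and>
     (\<forall>n\<ge>1. \<exists>!a. a \<in> (\<Pi>\<^sub>E i\<in>{1..m}. A i) \<and> n = (\<Prod>i=1..m. a i))"

definition harmonic_sum :: "nat set \<Rightarrow> ennreal" where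
  "harmonic_sum S = (\<Sum>\<^sub>\<infinity>s\<in>S. ennreal (1 / real s))"

definition density_quotient :: "nat set \<Rightarrow> real \<Rightarrow> real" where
  "density_quotient S x = real (card {n. 1 \<le> n \<and> real n \<le> x \<and> n \<in> S}) / x"

definition has_natural_density :: "nat set \<Rightarrow> bool" where
  "has_natural_density S \<longleftrightarrow> (\<exists>d. (density_quotient S \<longlongrightarrow> d) at_top)"

text \<open>Only meaningful for sets satisfying \<open>has_natural_density\<close>.\<close>

definition natural_density :: "nat set \<Rightarrow> real" where
  "natural_density S = Lim at_top (density_quotient S)"

end

theory Submission
  imports Defs "HOL-Computational_Algebra.Primes"
begin

text \<open>
  Grouping all factors but one, it suffices to treat a pair \<open>A\<close>, \<open>B\<close>. For a finite set \<open>P\<close> of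
  primes let \<open>S\<close> be the \<open>P\<close>-smooth numbers and \<open>\<rho>\<close> the density of the numbers free of primes
  from \<open>P\<close>. Then \<open>\<rho> H(S) = 1\<close> and \<open>H(S) = H(A \<inter> S) H(B \<inter> S)\<close>, so the set of \<open>n\<close> whose smooth
  part lies in \<open>A\<close> has density \<open>\<rho> H(A \<inter> S) = 1 / H(B \<inter> S)\<close>. This set agrees with \<open>A\<close> on all \<open>n\<close> that
  have no divisor in \<open>B - S\<close>. The exceptional \<open>n\<close> in \<open>A\<close> have upper density at most \<open>1 / M\<close> if
  \<open>B - S\<close> lies above \<open>M\<close>, because the quotient by a divisor in \<open>B\<close> determines \<open>n\<close>; this also covers
  \<open>H(B) = \<infinity>\<close>. All exceptional \<open>n\<close> together have upper density at most \<open>H(B - S)\<close>, which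
  tends to 0 as \<open>P\<close> exhausts the primes if \<open>H(B)\<close> is finite.
\<close>

subsection \<open>Harmonic sums of product sets\<close>

definition prods :: "nat set \<Rightarrow> nat set \<Rightarrow> nat set" where
  "prods A B = (\<lambda>(a, b). a * b) ` (A \<times> B)"

abbreviation unique_prods :: "nat set \<Rightarrow> nat set \<Rightarrow> bool" where
  "unique_prods A B \<equiv> inj_on (\<lambda>(a, b). a * b) (A \<times> B)"

lemma prodsI: "a \<in> A \<Longrightarrow> b \<in> B \<Longrightarrow> a * b \<in> prods A B"
  by (auto simp: prods_def)

lemma prodsE:
  assumes "n \<in> prods A B"
  obtains a b where "a \<in> A" "b \<in> B" "n = a * b"
  using assms by (auto simp: prods_def)

lemma finite_prods: "finite A \<Longrightarrow> finite B \<Longrightarrow> finite (prods A B)"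
  by (simp add: prods_def)

lemma prods_mono: "A \<subseteq> A' \<Longrightarrow> B \<subseteq> B' \<Longrightarrow> prods A B \<subseteq> prods A' B'"
  unfolding prods_def by (intro image_mono Sigma_mono)

lemma unique_prodsD:
  assumes "unique_prods A B" "a * b = a' * b'" "a \<in> A" "a' \<in> A" "b \<in> B" "b' \<in> B"
  shows "a = a'" "b = b'"
  using inj_onD[OF assms(1), of "(a, b)" "(a', b')"] assms by auto

lemma unique_prods_subset:
  "unique_prods A B \<Longrightarrow> A' \<subseteq> A \<Longrightarrow> B' \<subseteq> B \<Longrightarrow> unique_prods A' B'"
  by (erule inj_on_subset) auto

lemma harmonic_sum_SUP:
  "harmonic_sum S = (SUP F\<in>{F. finite F \<and> F \<subseteq> S}. ennreal (\<Sum>s\<in>F. 1 / real s))"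
  unfolding harmonic_sum_def
  by (subst nonneg_infsum_complete) (auto intro!: SUP_cong sum_ennreal)

lemma sum_le_harmonic_sum:
  "finite F \<Longrightarrow> F \<subseteq> S \<Longrightarrow> ennreal (\<Sum>s\<in>F. 1 / real s) \<le> harmonic_sum S"
  unfolding harmonic_sum_SUP by (rule SUP_upper) auto

lemma sum_reciprocals_prods:
  assumes "unique_prods F G"
  shows "(\<Sum>s\<in>prods F G. 1 / real s) = (\<Sum>s\<in>F. 1 / real s) * (\<Sum>s\<in>G. 1 / real s)"
  unfolding prods_def
  by (subst sum.reindex[OF assms]) (simp add: sum_product sum.cartesian_product case_prod_unfold)

text \<open>Finite sets suffice in both directions: a finite set of products lies in the product set
  of its two finite projections, and product sets of finite sets are finite. Working in
  \<open>ennreal\<close> includes infinite sums.\<close>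

lemma harmonic_sum_prods:
  assumes inj: "unique_prods A B"
  shows "harmonic_sum (prods A B) = harmonic_sum A * harmonic_sum B"
proof (rule antisym)
  show "harmonic_sum (prods A B) \<le> harmonic_sum A * harmonic_sum B"
    unfolding harmonic_sum_SUP[of "prods A B"]
  proof (rule SUP_least)
    fix F assume "F \<in> {F. finite F \<and> F \<subseteq> prods A B}"
    then obtain Q where Q: "Q \<subseteq> A \<times> B" "finite Q" "F = (\<lambda>(a, b). a * b) ` Q"
      unfolding prods_def by (blast dest: finite_subset_image)
    define FA FB where "FA = fst ` Q" and "FB = snd ` Q"
    have fin: "finite FA" "finite FB" and sub: "FA \<subseteq> A" "FB \<subseteq> B"
      using Q by (auto simp: FA_def FB_def)
    have F: "F \<subseteq> prods FA FB"
    proof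
      fix s assume "s \<in> F"
      then obtain q where "q \<in> Q" "s = fst q * snd q"
        using Q(3) by auto
      then show "s \<in> prods FA FB"
        by (simp add: FA_def FB_def prodsI)
    qed
    have "(\<Sum>s\<in>F. 1 / real s) \<le> (\<Sum>s\<in>prods FA FB. 1 / real s)"
      by (rule sum_mono2) (use fin F in \<open>auto intro: finite_prods\<close>)
    also have "\<dots> = (\<Sum>s\<in>FA. 1 / real s) * (\<Sum>s\<in>FB. 1 / real s)"
      by (rule sum_reciprocals_prods[OF unique_prods_subset[OF inj sub]])
    finally have "ennreal (\<Sum>s\<in>F. 1 / real s) \<le> ennreal (\<Sum>s\<in>FA. 1 / real s) * ennreal (\<Sum>s\<in>FB. 1 / real s)"
      by (simp add: ennreal_mult[symmetric] sum_nonneg ennreal_leI)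
    also have "\<dots> \<le> harmonic_sum A * harmonic_sum B"
      by (intro mult_mono sum_le_harmonic_sum fin sub) auto
    finally show "ennreal (\<Sum>s\<in>F. 1 / real s) \<le> harmonic_sum A * harmonic_sum B" .
  qed
next
  have "ennreal (\<Sum>s\<in>F. 1 / real s) * ennreal (\<Sum>s\<in>G. 1 / real s) \<le> harmonic_sum (prods A B)"
    if "finite F" "F \<subseteq> A" "finite G" "G \<subseteq> B" for F G
  proof -
    have "ennreal (\<Sum>s\<in>prods F G. 1 / real s) \<le> harmonic_sum (prods A B)"
      using that by (intro sum_le_harmonic_sum finite_prods prods_mono)
    then show ?thesis
      using sum_reciprocals_prods[OF unique_prods_subset[OF inj that(2,4)]]
      by (simp add: ennreal_mult[symmetric] sum_nonneg)
  qed
  \<comment> \<open>The supremum over \<open>G\<close> is taken first and the one over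
    \<open>F\<close> afterwards; multiplication by a constant commutes with suprema in
    \<open>ennreal\<close>.\<close>
  then have "ennreal (\<Sum>s\<in>F. 1 / real s) * harmonic_sum B \<le> harmonic_sum (prods A B)"
    if "finite F" "F \<subseteq> A" for F
    using that unfolding harmonic_sum_SUP[of B] SUP_mult_left_ennreal by (intro SUP_least) simp
  then show "harmonic_sum A * harmonic_sum B \<le> harmonic_sum (prods A B)"
    unfolding harmonic_sum_SUP[of A] SUP_mult_right_ennreal by (intro SUP_least) simp
qed

text \<open>Real-valued counterpart of \<open>harmonic_sum\<close>. The infinite sum defaults to 0
  when it diverges, so the value is meaningful only together with \<open>hsummable\<close>.\<close>

abbreviation hsum :: "nat set \<Rightarrow> real" where
  "hsum S \<equiv> (\<Sum>\<^sub>\<infinity>s\<in>S. 1 / real s)"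

abbreviation hsummable :: "nat set \<Rightarrow> bool" where
  "hsummable S \<equiv> (\<lambda>s. 1 / real s) summable_on S"

lemma hsummable_if_bounded:
  assumes "\<And>F. finite F \<Longrightarrow> F \<subseteq> S \<Longrightarrow> (\<Sum>s\<in>F. 1 / real s) \<le> c"
  shows "hsummable S"
  by (rule nonneg_bdd_above_summable_on) (use assms in \<open>auto intro!: bdd_aboveI[where M=c]\<close>)

lemma harmonic_sum_eq_hsum: "hsummable S \<Longrightarrow> harmonic_sum S = ennreal (hsum S)"
  unfolding harmonic_sum_SUP by (subst infsum_nonneg_is_SUPREMUM_ennreal) auto

lemma hsummable_if_finite:
  assumes "harmonic_sum S \<noteq> \<infinity>"
  shows "hsummable S"
proof (rule hsummable_if_bounded)
  fix F assume "finite F" "F \<subseteq> S"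
  then have "ennreal (\<Sum>s\<in>F. 1 / real s) \<le> harmonic_sum S"
    by (rule sum_le_harmonic_sum)
  also have "\<dots> = ennreal (enn2real (harmonic_sum S))"
    using assms by (simp add: less_top)
  finally show "(\<Sum>s\<in>F. 1 / real s) \<le> enn2real (harmonic_sum S)"
    by (simp add: ennreal_le_iff)
qed

lemma hsum_prods:
  assumes "unique_prods A B" "hsummable A" "hsummable B" "hsummable (prods A B)"
  shows "hsum (prods A B) = hsum A * hsum B"
  using harmonic_sum_prods[OF assms(1)] assms(2-)
  by (simp add: harmonic_sum_eq_hsum ennreal_mult[symmetric] infsum_nonneg)

subsection \<open>Density quotients\<close>

abbreviation dens :: "nat set \<Rightarrow> real \<Rightarrow> bool" where
  "dens S d \<equiv> (density_quotient S \<longlongrightarrow> d) at_top"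

lemma finite_count: "finite {n::nat. 1 \<le> n \<and> real n \<le> x \<and> n \<in> S}"
proof (rule finite_subset)
  show "{n. 1 \<le> n \<and> real n \<le> x \<and> n \<in> S} \<subseteq> {..nat \<lfloor>x\<rfloor>}"
    by (auto simp: le_nat_floor)
qed simp

text \<open>The count starts at 1, so only the positive elements of \<open>S\<close> have to be
  compared.\<close>

lemma density_quotient_mono:
  assumes "x > 0" "S \<inter> {1..} \<subseteq> T"
  shows "density_quotient S x \<le> density_quotient T x"
  unfolding density_quotient_def
  by (intro divide_right_mono of_nat_mono card_mono finite_count) (use assms in auto)

lemma density_quotient_Un_le:
  assumes "x > 0"
  shows "density_quotient (S \<union> T) x \<le> density_quotient S x + density_quotient T x"
proof -
  have "{n. 1 \<le> n \<and> real n \<le> x \<and> n \<in> S \<union> T} =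
      {n. 1 \<le> n \<and> real n \<le> x \<and> n \<in> S} \<union> {n. 1 \<le> n \<and> real n \<le> x \<and> n \<in> T}"
    by auto
  from arg_cong[OF this, of card] have "card {n. 1 \<le> n \<and> real n \<le> x \<and> n \<in> S \<union> T} \<le>
      card {n. 1 \<le> n \<and> real n \<le> x \<and> n \<in> S} + card {n. 1 \<le> n \<and> real n \<le> x \<and> n \<in> T}"
    using card_Un_le by (rule ord_eq_le_trans)
  then show ?thesis
    using assms by (simp add: density_quotient_def add_divide_distrib[symmetric] divide_right_mono)
qed

lemma density_quotient_Un_disjoint:
  assumes "S \<inter> T = {}"
  shows "density_quotient (S \<union> T) x = density_quotient S x + density_quotient T x"
proof -
  have "{n. 1 \<le> n \<and> real n \<le> x \<and> n \<in> S \<union> T} =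
      {n. 1 \<le> n \<and> real n \<le> x \<and> n \<in> S} \<union> {n. 1 \<le> n \<and> real n \<le> x \<and> n \<in> T}"
    by auto
  moreover have "{n. 1 \<le> n \<and> real n \<le> x \<and> n \<in> S} \<inter> {n. 1 \<le> n \<and> real n \<le> x \<and> n \<in> T} = {}"
    using assms by auto
  ultimately have "card {n. 1 \<le> n \<and> real n \<le> x \<and> n \<in> S \<union> T} =
      card {n. 1 \<le> n \<and> real n \<le> x \<and> n \<in> S} + card {n. 1 \<le> n \<and> real n \<le> x \<and> n \<in> T}"
    by (simp only: card_Un_disjoint[OF finite_count finite_count])
  then show ?thesis
    unfolding density_quotient_def by (simp only: of_nat_add add_divide_distrib)
qed

lemma card_count_le:
  assumes "x \<ge> 0"
  shows "real (card {n. 1 \<le> n \<and> real n \<le> x \<and> n \<in> S}) \<le> x"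
proof -
  have "card {n. 1 \<le> n \<and> real n \<le> x \<and> n \<in> S} \<le> card {1..nat \<lfloor>x\<rfloor>}"
    by (intro card_mono) (auto simp: le_nat_floor)
  then show ?thesis
    using assms by simp linarith
qed

lemma density_quotient_le_1: "x > 0 \<Longrightarrow> density_quotient S x \<le> 1"
  using card_count_le[of x S] by (simp add: density_quotient_def)

lemma density_quotient_dilate:
  assumes "u \<ge> 1"
  shows "density_quotient ((*) u ` T) x = density_quotient T (x / real u) / real u"
proof -
  have "{n. 1 \<le> n \<and> real n \<le> x \<and> n \<in> (*) u ` T} =
      (*) u ` {n. 1 \<le> n \<and> real n \<le> x / real u \<and> n \<in> T}"
    using assms by (auto simp: field_simps)
  moreover have "inj_on ((*) u) {n. 1 \<le> n \<and> real n \<le> x / real u \<and> n \<in> T}"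
    using assms by (auto intro!: inj_onI)
  ultimately show ?thesis
    using assms by (simp add: density_quotient_def card_image)
qed

lemma dens_dilate:
  assumes "u \<ge> 1" "dens T d"
  shows "dens ((*) u ` T) (d / real u)"
proof -
  have "filterlim (\<lambda>x. x / real u) at_top at_top"
    \<comment> \<open>Division by \<open>u\<close> is read as multiplication by the constant
      function \<open>1 / real u\<close>, whose limit is positive.\<close>
    using assms(1) by (intro filterlim_at_top_mult_tendsto_pos[OF tendsto_const _ filterlim_ident, of "1 / real u", simplified]) auto
  from tendsto_divide[OF filterlim_compose[OF assms(2) this] tendsto_const[of "real u"]]
  show ?thesis
    using assms(1) by (simp add: density_quotient_dilate[OF assms(1), abs_def])
qed

lemma dens_UNIV: "dens UNIV 1"
proof (rule tendsto_sandwich)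
  show "\<forall>\<^sub>F x in at_top. 1 - 1 / x \<le> density_quotient UNIV x"
    using eventually_gt_at_top[of 0]
  proof eventually_elim
    case (elim x)
    have "{n. 1 \<le> n \<and> real n \<le> x \<and> n \<in> UNIV} = {1..nat \<lfloor>x\<rfloor>}"
      using elim by (auto simp: le_nat_floor) linarith
    then have "x - 1 \<le> real (card {n. 1 \<le> n \<and> real n \<le> x \<and> n \<in> UNIV})"
      using elim by simp
    then have "(x - 1) / x \<le> density_quotient UNIV x"
      unfolding density_quotient_def using elim by (intro divide_right_mono) auto
    then show ?case
      using elim by (simp add: diff_divide_distrib)
  qed
  show "\<forall>\<^sub>F x in at_top. density_quotient UNIV x \<le> 1"
    using eventually_gt_at_top[of 0] by eventually_elim (rule density_quotient_le_1)
  show "((\<lambda>x::real. 1 - 1 / x) \<longlongrightarrow> 1) at_top"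
    using tendsto_diff[OF tendsto_const tendsto_inverse_0_at_top[OF filterlim_ident], of 1]
    by (simp add: inverse_eq_divide)
qed simp

text \<open>Union bound: at most \<open>x / v\<close> multiples of \<open>v\<close> lie below
  \<open>x\<close>. There is no error term per \<open>v\<close>, so \<open>V\<close> may be infinite
  and the bound is uniform in \<open>x\<close>.\<close>

lemma density_quotient_multiples_le:
  assumes "V \<subseteq> {1..}" "hsummable V" "x > 0"
  shows "density_quotient {n. \<exists>v\<in>V. v dvd n} x \<le> hsum V"
proof -
  \<comment> \<open>A divisor of a positive \<open>n \<le> x\<close> is itself at most
    \<open>x\<close>, so finitely many \<open>v\<close> matter for each \<open>x\<close>.\<close>
  define W where "W = {n. 1 \<le> n \<and> real n \<le> x \<and> n \<in> V}"
  have fin: "finite W"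
    unfolding W_def by (rule finite_count)
  have "{n. 1 \<le> n \<and> real n \<le> x \<and> n \<in> {n. \<exists>v\<in>V. v dvd n}} \<subseteq>
      (\<Union>v\<in>W. (*) v ` {m. 1 \<le> m \<and> real m \<le> x / real v \<and> m \<in> UNIV})"
  proof
    fix n assume "n \<in> {n. 1 \<le> n \<and> real n \<le> x \<and> n \<in> {n. \<exists>v\<in>V. v dvd n}}"
    then obtain v m where n: "1 \<le> n" "real n \<le> x" "v \<in> V" "n = v * m"
      by auto
    moreover have "v \<le> n" "1 \<le> v" "1 \<le> m"
      using n by auto
    ultimately have "v \<in> W" "real m \<le> x / real v"
      by (auto simp: W_def field_simps intro: order_trans[of _ "real n"])
    then show "n \<in> (\<Union>v\<in>W. (*) v ` {m. 1 \<le> m \<and> real m \<le> x / real v \<and> m \<in> UNIV})"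
      using n \<open>1 \<le> m\<close> by auto
  qed
  then have "card {n. 1 \<le> n \<and> real n \<le> x \<and> n \<in> {n. \<exists>v\<in>V. v dvd n}} \<le>
      card (\<Union>v\<in>W. (*) v ` {m. 1 \<le> m \<and> real m \<le> x / real v \<and> m \<in> UNIV})"
    by (rule card_mono[rotated]) (auto intro!: fin finite_imageI finite_count[of _ UNIV, simplified])
  also have "\<dots> \<le> (\<Sum>v\<in>W. card ((*) v ` {m. 1 \<le> m \<and> real m \<le> x / real v \<and> m \<in> UNIV}))"
    by (rule card_UN_le[OF fin])
  also have "\<dots> \<le> (\<Sum>v\<in>W. card {m. 1 \<le> m \<and> real m \<le> x / real v \<and> m \<in> UNIV})"
    by (intro sum_mono card_image_le finite_count)
  finally have "real (card {n. 1 \<le> n \<and> real n \<le> x \<and> n \<in> {n. \<exists>v\<in>V. v dvd n}}) \<le>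
      real (\<Sum>v\<in>W. card {m. 1 \<le> m \<and> real m \<le> x / real v \<and> m \<in> UNIV})"
    by (rule of_nat_mono)
  also have "\<dots> \<le> (\<Sum>v\<in>W. x / real v)"
    unfolding of_nat_sum using assms(3) by (intro sum_mono card_count_le) auto
  also have "\<dots> = x * (\<Sum>v\<in>W. 1 / real v)"
    by (simp add: sum_distrib_left)
  also have "\<dots> \<le> x * hsum V"
    using assms(3) by (intro mult_left_mono finite_sum_le_infsum assms(2) fin) (auto simp: W_def)
  finally show ?thesis
    using assms(3) by (simp add: density_quotient_def field_simps)
qed

subsection \<open>Smooth and rough numbers\<close>

definition smooth :: "nat set \<Rightarrow> nat set" where
  "smooth P = {n. 0 < n \<and> (\<forall>p. prime p \<and> p dvd n \<longrightarrow> p \<in> P)}"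

definition rough :: "nat set \<Rightarrow> nat set" where
  "rough P = {n. 0 < n \<and> (\<forall>p\<in>P. \<not> p dvd n)}"

lemma one_smooth: "1 \<in> smooth P"
  by (auto simp: smooth_def)

lemma smooth_dvd: "n \<in> smooth P \<Longrightarrow> d dvd n \<Longrightarrow> d \<in> smooth P"
  by (auto simp: smooth_def intro: dvd_trans dvd_pos_nat)

lemma smooth_mult: "a \<in> smooth P \<Longrightarrow> b \<in> smooth P \<Longrightarrow> a * b \<in> smooth P"
  by (auto simp: smooth_def prime_dvd_mult_iff)

lemma coprime_smooth_rough:
  assumes "u \<in> smooth P" "v \<in> rough P"
  shows "coprime u v"
proof (rule ccontr)
  assume "\<not> coprime u v"
  then obtain p where "prime p" "p dvd gcd u v"
    by (metis coprime_iff_gcd_eq_1 prime_factor_nat)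
  then show False
    using assms by (auto simp: smooth_def rough_def)
qed

text \<open>Since \<open>u\<close> is coprime to \<open>v'\<close>, it divides \<open>u'\<close>; by
  symmetry the two smooth parts divide each other.\<close>

lemma unique_smooth_rough: "unique_prods (smooth P) (rough P)"
proof (rule inj_onI, clarify)
  fix u v u' v'
  assume *: "u \<in> smooth P" "v \<in> rough P" "u' \<in> smooth P" "v' \<in> rough P" "u * v = u' * v'"
  have "u dvd u'" "u' dvd u"
    using * coprime_smooth_rough by (metis coprime_dvd_mult_left_iff dvd_triv_left)+
  then have "u = u'"
    by (rule dvd_antisym)
  then show "u = u' \<and> v = v'"
    using * by (auto simp: smooth_def)
qed

text \<open>Strong induction, moving one prime of \<open>P\<close> at a time into the smooth
  part.\<close>

lemma smooth_rough_decomposition: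
  assumes "\<And>p. p \<in> P \<Longrightarrow> prime p" "0 < n"
  shows "n \<in> prods (smooth P) (rough P)"
  using assms(2)
proof (induction n rule: less_induct)
  case (less n)
  show ?case
  proof (cases "n \<in> rough P")
    case True
    then show ?thesis
      using prodsI[OF one_smooth] by fastforce
  next
    case False
    then obtain p k where p: "p \<in> P" "n = p * k"
      using less.prems by (auto simp: rough_def)
    then have "prime p"
      using assms(1) by blast
    then have "0 < k" "k < n"
      using less.prems p prime_gt_1_nat[of p] by auto
    have "p \<in> smooth P"
      using \<open>prime p\<close> p(1) by (auto simp: smooth_def prime_gt_0_nat dest: primes_dvd_imp_eq)
    with less.IH \<open>0 < k\<close> \<open>k < n\<close> obtain u v where "u \<in> smooth P" "v \<in> rough P" "k = u * v"
      by (metis prodsE)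
    then show ?thesis
      using prodsI[OF smooth_mult, of p P u v] p \<open>p \<in> smooth P\<close> by (simp add: mult.assoc)
  qed
qed

text \<open>A new prime \<open>p\<close> removes from \<open>rough P\<close> exactly its dilate by
  \<open>p\<close>, so the density is multiplied by \<open>1 - 1 / p > 0\<close>.\<close>

lemma dens_rough:
  assumes "finite P" "\<And>p. p \<in> P \<Longrightarrow> prime p"
  shows "\<exists>\<rho>>0. dens (rough P) \<rho>"
  using assms
proof (induction P rule: finite_induct)
  case empty
  have "density_quotient (rough {}) = density_quotient UNIV"
    by (intro ext) (auto simp: density_quotient_def rough_def intro!: arg_cong[where f=card])
  then show ?case
    using dens_UNIV by (auto intro!: exI[of _ 1])
next
  case (insert p P)
  then obtain \<rho> where \<rho>: "\<rho> > 0" "dens (rough P) \<rho>"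
    by auto
  have p: "prime p"
    using insert.prems by auto
  \<comment> \<open>The primes \<open>p\<close> and \<open>q\<close> differ because \<open>p\<close>
    is not in \<open>P\<close>; hence multiplication by \<open>p\<close> does not affect roughness
    for \<open>P\<close>.\<close>
  have pq: "q dvd p * k \<longleftrightarrow> q dvd k" if "q \<in> P" for q k
    using that insert.prems[of q] insert.hyps p
    by (metis insert_iff prime_dvd_mult_iff primes_dvd_imp_eq)
  have eq: "rough P = rough (insert p P) \<union> (*) p ` rough P"
  proof (intro equalityI subsetI)
    fix n assume "n \<in> rough P"
    then show "n \<in> rough (insert p P) \<union> (*) p ` rough P"
      by (cases "p dvd n") (auto simp: rough_def pq)
  qed (use prime_gt_0_nat[OF p] in \<open>auto simp: rough_def pq\<close>)
  moreover have "rough (insert p P) \<inter> (*) p ` rough P = {}"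
    by (auto simp: rough_def)
  ultimately have "density_quotient (rough (insert p P)) =
      (\<lambda>x. density_quotient (rough P) x - density_quotient ((*) p ` rough P) x)"
    using density_quotient_Un_disjoint by (metis add_diff_cancel_right')
  moreover have "((\<lambda>x. density_quotient (rough P) x - density_quotient ((*) p ` rough P) x)
      \<longlongrightarrow> \<rho> - \<rho> / real p) at_top"
    using prime_ge_1_nat[OF p] \<rho> by (intro tendsto_diff dens_dilate)
  ultimately have "dens (rough (insert p P)) (\<rho> - \<rho> / real p)"
    by simp
  moreover have "\<rho> - \<rho> / real p > 0"
    using \<rho> prime_gt_1_nat[OF p] by (simp add: field_simps)
  ultimately show ?case
    by blast
qed

text \<open>By uniqueness of the smooth part the set is a disjoint union of the dilates of
  \<open>rough P\<close> by \<open>u\<close>, each of density \<open>\<rho> / u\<close>.\<close>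

lemma dens_prods_rough_finite:
  assumes "dens (rough P) \<rho>" "finite U" "U \<subseteq> smooth P"
  shows "dens (prods U (rough P)) (\<rho> * (\<Sum>u\<in>U. 1 / real u))"
  using assms(2,3)
proof (induction U rule: finite_induct)
  case empty
  then show ?case
    by (simp add: prods_def density_quotient_def[abs_def])
next
  case (insert u U)
  have "prods (insert u U) (rough P) = (*) u ` rough P \<union> prods U (rough P)"
    by (auto simp: prods_def)
  moreover have "(*) u ` rough P \<inter> prods U (rough P) = {}"
    using insert unique_prodsD(1)[OF unique_smooth_rough] by (fastforce elim!: prodsE)
  ultimately have "density_quotient (prods (insert u U) (rough P)) =
      (\<lambda>x. density_quotient ((*) u ` rough P) x + density_quotient (prods U (rough P)) x)"
    using density_quotient_Un_disjoint by auto
  moreover have "((\<lambda>x. density_quotient ((*) u ` rough P) x + density_quotient (prods U (rough P)) x)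
      \<longlongrightarrow> \<rho> / real u + \<rho> * (\<Sum>u\<in>U. 1 / real u)) at_top"
    using insert by (intro tendsto_add dens_dilate assms(1) insert.IH) (auto simp: smooth_def)
  ultimately show ?case
    using insert by (simp add: algebra_simps)
qed

text \<open>Densities are at most 1, so every finite partial sum is at most
  \<open>1 / \<rho>\<close>; this takes the place of an Euler product.\<close>

lemma hsummable_smooth:
  assumes "finite P" "\<And>p. p \<in> P \<Longrightarrow> prime p"
  shows "hsummable (smooth P)"
proof -
  obtain \<rho> where \<rho>: "\<rho> > 0" "dens (rough P) \<rho>"
    using dens_rough[OF assms] by auto
  show ?thesis
  proof (rule hsummable_if_bounded)
    fix F assume "finite F" "F \<subseteq> smooth P"
    from dens_prods_rough_finite[OF \<rho>(2) this]
    have "\<rho> * (\<Sum>u\<in>F. 1 / real u) \<le> 1"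
      by (rule tendsto_upperbound)
        (auto intro!: density_quotient_le_1 eventually_mono[OF eventually_gt_at_top[of 0]])
    then show "(\<Sum>u\<in>F. 1 / real u) \<le> 1 / \<rho>"
      using \<rho>(1) by (simp add: field_simps)
  qed
qed

lemma hsummable_subset: "hsummable S \<Longrightarrow> T \<subseteq> S \<Longrightarrow> hsummable T"
  by (rule summable_on_subset_banach)

lemma hsum_mono: "hsummable S \<Longrightarrow> T \<subseteq> S \<Longrightarrow> hsum T \<le> hsum S"
  by (rule infsum_mono_neutral) (auto intro: hsummable_subset)

lemma hsum_approx:
  assumes "hsummable S" "e > 0"
  obtains F where "finite F" "F \<subseteq> S" "hsum (S - F) < e"
proof -
  have "((\<lambda>s. 1 / real s) has_sum hsum S) S"
    using assms(1) by simp
  then have "\<forall>\<^sub>F F in finite_subsets_at_top S. dist (\<Sum>s\<in>F. 1 / real s) (hsum S) < e"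
    unfolding has_sum_def using assms(2) by (rule tendstoD)
  then obtain F where F: "finite F" "F \<subseteq> S" "dist (\<Sum>s\<in>F. 1 / real s) (hsum S) < e"
    unfolding eventually_finite_subsets_at_top by auto
  moreover have "hsum (S - F) = hsum S - (\<Sum>s\<in>F. 1 / real s)"
    using infsum_Diff[OF assms(1) _ F(2)] F(1) by simp
  ultimately show ?thesis
    by (intro that[of F]) (auto simp: dist_real_def)
qed

text \<open>Truncate \<open>T\<close> to a finite \<open>F\<close>. What is lost consists of
  multiples of elements of \<open>T - F\<close>, whose density quotient is bounded by the tail
  uniformly in \<open>x\<close>.\<close>

lemma dens_prods_rough:
  assumes "finite P" "\<And>p. p \<in> P \<Longrightarrow> prime p" "dens (rough P) \<rho>" "T \<subseteq> smooth P"
  shows "dens (prods T (rough P)) (\<rho> * hsum T)"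
proof -
  have sT: "hsummable T"
    using hsummable_subset[OF hsummable_smooth[OF assms(1,2)] assms(4)] by auto
  have rho0: "\<rho> \<ge> 0"
    by (rule tendsto_lowerbound[OF assms(3)])
      (auto simp: density_quotient_def intro!: eventually_mono[OF eventually_gt_at_top[of 0]])
  show ?thesis
  proof (rule tendstoI)
    fix e :: real assume "e > 0"
    \<comment> \<open>The upper estimate loses \<open>\<delta>\<close> by convergence for
      \<open>F\<close> and \<open>\<delta>\<close> by the tail; the lower one loses
      \<open>\<delta>\<close> and \<open>\<rho> * \<delta>\<close>. Both losses are at most
      \<open>(2 + \<rho>) * \<delta> = e\<close>.\<close>
    define \<delta> where "\<delta> = e / (2 + \<rho>)"
    have \<delta>: "\<delta> > 0"
      using \<open>e > 0\<close> rho0 by (simp add: \<delta>_def)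
    obtain F where F: "finite F" "F \<subseteq> T" "hsum (T - F) < \<delta>"
      by (rule hsum_approx[OF sT \<delta>])
    have hT: "hsum (T - F) = hsum T - (\<Sum>s\<in>F. 1 / real s)"
      using infsum_Diff[OF sT _ F(2)] F(1) by simp
    have "dens (prods F (rough P)) (\<rho> * (\<Sum>u\<in>F. 1 / real u))"
      using F assms by (intro dens_prods_rough_finite) auto
    then have "\<forall>\<^sub>F x in at_top.
        dist (density_quotient (prods F (rough P)) x) (\<rho> * (\<Sum>u\<in>F. 1 / real u)) < \<delta>"
      using \<delta> by (rule tendstoD)
    then show "\<forall>\<^sub>F x in at_top. dist (density_quotient (prods T (rough P)) x) (\<rho> * hsum T) < e"
      using eventually_gt_at_top[of 0]
    proof eventually_elim
      case (elim x)
      have "density_quotient (prods F (rough P)) x \<le> density_quotient (prods T (rough P)) x"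
        using elim F(2) prods_mono[of F T "rough P" "rough P"] by (intro density_quotient_mono) auto
      moreover have "density_quotient (prods T (rough P)) x \<le>
          density_quotient (prods F (rough P) \<union> {n. \<exists>v\<in>T - F. v dvd n}) x"
        using elim by (intro density_quotient_mono) (auto intro: prodsI dvd_triv_left elim!: prodsE)
      moreover have "\<dots> \<le> density_quotient (prods F (rough P)) x
          + density_quotient {n. \<exists>v\<in>T - F. v dvd n} x"
        using elim by (intro density_quotient_Un_le) auto
      moreover have "density_quotient {n. \<exists>v\<in>T - F. v dvd n} x \<le> hsum (T - F)"
        using elim assms(4) by (intro density_quotient_multiples_le hsummable_subset[OF sT])
          (auto simp: smooth_def)
      moreover have "\<rho> * hsum (T - F) \<le> \<rho> * \<delta>" "0 \<le> \<rho> * hsum (T - F)"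
        using F rho0 by (auto intro!: mult_left_mono mult_nonneg_nonneg infsum_nonneg)
      moreover have "e = 2 * \<delta> + \<rho> * \<delta>"
      proof -
        have "e = \<delta> * (2 + \<rho>)"
          using rho0 by (simp add: \<delta>_def)
        then show ?thesis
          by (simp add: algebra_simps)
      qed
      ultimately show ?case
        using elim F(3) hT unfolding dist_real_def by (simp add: algebra_simps abs_less_iff)
    qed
  qed
qed

lemma dens_rough_hsum_smooth:
  assumes "finite P" "\<And>p. p \<in> P \<Longrightarrow> prime p" "dens (rough P) \<rho>"
  shows "\<rho> * hsum (smooth P) = 1"
proof -
  \<comment> \<open>The two sets differ only in 0, which is not counted.\<close>
  have "density_quotient (prods (smooth P) (rough P)) = density_quotient UNIV"
    using smooth_rough_decomposition[OF assms(2)]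
    by (intro ext) (auto simp: density_quotient_def intro!: arg_cong[where f=card])
  then show ?thesis
    using dens_prods_rough[OF assms order_refl] dens_UNIV
    by (auto intro: tendsto_unique[rotated])
qed

subsection \<open>Pairs of direct factors\<close>

text \<open>The case of two factors: \<open>A\<close> is the factor whose density is sought, and
  \<open>B\<close> will be the set of products of all the others.\<close>

locale factor_pair =
  fixes A B :: "nat set"
  assumes A_pos: "A \<subseteq> {1..}" and B_pos: "B \<subseteq> {1..}"
    and unique: "unique_prods A B"
    and prods_eq: "prods A B = {1..}"
begin

lemma factorization:
  assumes "0 < n"
  obtains a b where "a \<in> A" "b \<in> B" "n = a * b"
  using prods_eq assms by (metis prodsE atLeast_iff One_nat_def Suc_leI)

lemma one_mem: "1 \<in> A" "1 \<in> B"
  using factorization[of 1] by (metis nat_mult_eq_1_iff zero_less_one)+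

text \<open>Divisors of a smooth number are smooth, so its factorization stays inside
  \<open>smooth P\<close>.\<close>

lemma prods_smooth: "prods (A \<inter> smooth P) (B \<inter> smooth P) = smooth P"
proof (intro equalityI subsetI)
  fix n assume "n \<in> smooth P"
  moreover from this obtain a b where "a \<in> A" "b \<in> B" "n = a * b"
    using factorization by (auto simp: smooth_def)
  ultimately show "n \<in> prods (A \<inter> smooth P) (B \<inter> smooth P)"
    using smooth_dvd[of n P] by (auto intro!: prodsI)
qed (auto elim!: prodsE intro: smooth_mult)

text \<open>Induction over the divisors of \<open>u\<close>. The \<open>B\<close>-part
  \<open>b\<close> of \<open>u * v\<close> is smooth, hence coprime to \<open>v\<close>, hence a
  divisor of \<open>u\<close>. Thus the \<open>A\<close>-part of \<open>u * v\<close> is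
  \<open>(u / b) * v\<close>, to which the induction hypothesis applies when
  \<open>b \<noteq> 1\<close>.\<close>

lemma smooth_part_mem_iff:
  assumes "v \<in> rough P" "u \<in> smooth P"
    and "\<And>b. b \<in> B \<Longrightarrow> b dvd u * v \<Longrightarrow> b \<in> smooth P"
  shows "u \<in> A \<longleftrightarrow> u * v \<in> A"
  using assms(2,3)
proof (induction u rule: less_induct)
  case (less u)
  have pos: "0 < u" "0 < v"
    using less.prems assms(1) by (auto simp: smooth_def rough_def)
  obtain a b where ab: "a \<in> A" "b \<in> B" "u * v = a * b"
    using factorization[of "u * v"] pos by auto
  obtain a' b' where ab': "a' \<in> A" "b' \<in> B" "u = a' * b'"
    using factorization[of u] pos by auto
  \<comment> \<open>The assumption on divisors in \<open>B\<close> is inherited, because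
    \<open>w * v\<close> divides \<open>u * v\<close>.\<close>
  have IH: "w \<in> A \<longleftrightarrow> w * v \<in> A" if "w < u" "w dvd u" for w
    using that less.prems smooth_dvd[of u P w] dvd_trans[OF _ mult_dvd_mono[OF that(2) dvd_refl, of v]]
    by (intro less.IH) auto
  have "b \<in> smooth P"
    using less.prems(2)[OF ab(2)] ab(3) by simp
  then have "b dvd u"
    using coprime_smooth_rough[OF _ assms(1)] ab(3) by (metis coprime_dvd_mult_left_iff dvd_triv_right)
  then obtain w where w: "u = w * b"
    by (auto simp: dvd_def mult.commute)
  then have a: "a = w * v"
    using ab(3) pos by auto
  \<comment> \<open>Both memberships hold if \<open>b = 1\<close>, and both fail otherwise.\<close>
  show ?case
  proof (cases "b = 1")
    case True
    then have uv: "u * v \<in> A"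
      using ab by simp
    have "b' = 1"
    proof (rule ccontr)
      assume "b' \<noteq> 1"
      then have "a' < u" "a' dvd u"
        using ab'(3) pos by (cases b'; auto)+
      then have "a' * v \<in> A"
        using IH ab'(1) by blast
      \<comment> \<open>The clashing factorizations of \<open>u * v\<close> are
        \<open>(a' * v) * b'\<close> and \<open>(u * v) * 1\<close>.\<close>
      from unique_prodsD(2)[OF unique _ this uv ab'(2) one_mem(2)] show False
        using \<open>b' \<noteq> 1\<close> ab'(3) by (simp add: mult_ac)
    qed
    then show ?thesis
      using uv ab' by simp
  next
    case False
    then have "w < u" "w dvd u"
      using w pos by (cases b; auto)+
    then have "w \<in> A"
      using IH a ab(1) by blast
    \<comment> \<open>Here \<open>u = w * b\<close> with \<open>b \<noteq> 1\<close> rules out the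
      factorization \<open>u * 1\<close>; the same argument then serves for
      \<open>u * v = a * b\<close>.\<close>
    from unique_prodsD(2)[OF unique _ _ this one_mem(2) ab(2), of u] have "u \<notin> A"
      using False w by auto
    moreover from unique_prodsD(2)[OF unique _ _ ab(1) one_mem(2) ab(2), of "u * v"] have "u * v \<notin> A"
      using False ab(3) by auto
    ultimately show ?thesis
      by blast
  qed
qed

text \<open>An element \<open>n \<in> A\<close> divisible by \<open>b \<in> B\<close> is determined by \<open>n / b\<close>, because
  \<open>n b' = n' b\<close> whenever \<open>n / b = n' / b'\<close>.\<close>

lemma density_quotient_multiples_in_factor_le:
  assumes "V \<subseteq> B" "\<And>b. b \<in> V \<Longrightarrow> M \<le> real b" "M > 0" "x > 0"
  shows "density_quotient {n\<in>A. \<exists>b\<in>V. b dvd n} x \<le> 1 / M"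
proof -
  let ?C = "{n. 1 \<le> n \<and> real n \<le> x \<and> n \<in> {n\<in>A. \<exists>b\<in>V. b dvd n}}"
  let ?D = "{n. 1 \<le> n \<and> real n \<le> x / M \<and> n \<in> UNIV}"
  have "\<exists>\<beta>. \<forall>n\<in>?C. \<beta> n \<in> V \<and> \<beta> n dvd n"
    by (rule bchoice) auto
  then obtain \<beta> where \<beta>: "\<And>n. n \<in> ?C \<Longrightarrow> \<beta> n \<in> V" "\<And>n. n \<in> ?C \<Longrightarrow> \<beta> n dvd n"
    by auto
  define q where "q n = n div \<beta> n" for n
  have q: "n = q n * \<beta> n" if "n \<in> ?C" for n
    using \<beta>(2)[OF that] by (simp add: q_def)
  have "inj_on q ?C"
  proof (rule inj_onI)
    fix n n' assume n: "n \<in> ?C" "n' \<in> ?C" "q n = q n'"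
    then have "n * \<beta> n' = n' * \<beta> n"
      using q[OF n(1)] q[OF n(2)] by (metis mult.assoc mult.commute)
    then show "n = n'"
      using unique_prodsD(1)[OF unique] \<beta>(1)[OF n(1)] \<beta>(1)[OF n(2)] n assms(1) by blast
  qed
  moreover have "q ` ?C \<subseteq> ?D"
  proof (rule image_subsetI)
    fix n assume n: "n \<in> ?C"
    have "0 < n" "real n \<le> x"
      using n by auto
    then have "q n \<noteq> 0"
      using q[OF n] by (metis mult_0 less_irrefl)
    moreover have "real (q n) * M \<le> real (q n) * real (\<beta> n)"
      using assms(2)[OF \<beta>(1)[OF n]] by (intro mult_left_mono) auto
    moreover have "real (q n) * real (\<beta> n) = real n"
      using q[OF n] by (metis of_nat_mult)
    ultimately show "q n \<in> ?D"
      using \<open>real n \<le> x\<close> assms(3) by (simp add: pos_le_divide_eq)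
  qed
  ultimately have "card ?C \<le> card ?D"
    by (intro card_inj_on_le[of q] finite_count)
  also have "real (card ?D) \<le> x / M"
    using assms by (intro card_count_le) auto
  finally have "real (card ?C) / x \<le> x / M / x"
    using assms by (intro divide_right_mono) auto
  then show ?thesis
    using assms by (simp add: density_quotient_def)
qed

text \<open>An element of \<open>A\<close> without a divisor in \<open>B - smooth P\<close> has its
  smooth part in \<open>A\<close>. The error \<open>1 / M\<close> does not involve the harmonic sum
  of \<open>B\<close>, so the bound also serves the infinite case.\<close>

lemma density_quotient_upper:
  assumes "\<And>p. p \<in> P \<Longrightarrow> prime p" "\<And>b. b \<in> B - smooth P \<Longrightarrow> M \<le> real b" "M > 0" "x > 0"
  shows "density_quotient A x \<le> density_quotient (prods (A \<inter> smooth P) (rough P)) x + 1 / M"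
proof -
  have "A \<inter> {1..} \<subseteq> prods (A \<inter> smooth P) (rough P) \<union> {n\<in>A. \<exists>b\<in>B - smooth P. b dvd n}"
  proof
    fix n assume n: "n \<in> A \<inter> {1..}"
    then obtain u v where uv: "u \<in> smooth P" "v \<in> rough P" "n = u * v"
      using smooth_rough_decomposition[OF assms(1), of P n] by (auto elim: prodsE)
    show "n \<in> prods (A \<inter> smooth P) (rough P) \<union> {n\<in>A. \<exists>b\<in>B - smooth P. b dvd n}"
    proof (cases "\<exists>b\<in>B - smooth P. b dvd n")
      case False
      then have "u \<in> A"
        using smooth_part_mem_iff[OF uv(2,1)] uv(3) n by auto
      then show ?thesis
        using uv by (auto intro: prodsI)
    qed (use n in auto)
  qed
  then have "density_quotient A x \<le>
      density_quotient (prods (A \<inter> smooth P) (rough P) \<union> {n\<in>A. \<exists>b\<in>B - smooth P. b dvd n}) x"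
    by (rule density_quotient_mono[OF assms(4)])
  also have "\<dots> \<le> density_quotient (prods (A \<inter> smooth P) (rough P)) x
      + density_quotient {n\<in>A. \<exists>b\<in>B - smooth P. b dvd n} x"
    by (rule density_quotient_Un_le[OF assms(4)])
  also have "density_quotient {n\<in>A. \<exists>b\<in>B - smooth P. b dvd n} x \<le> 1 / M"
    using assms by (intro density_quotient_multiples_in_factor_le) auto
  finally show ?thesis
    by simp
qed

text \<open>The exceptional numbers here lie outside \<open>A\<close>, so they are not determined by
  a cofactor; the union bound over \<open>B - smooth P\<close> replaces
  \<open>1 / M\<close>.\<close>

lemma density_quotient_lower:
  assumes "hsummable B" "x > 0"
  shows "density_quotient (prods (A \<inter> smooth P) (rough P)) x \<le> density_quotient A x + hsum (B - smooth P)"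
proof -
  have "prods (A \<inter> smooth P) (rough P) \<subseteq> A \<union> {n. \<exists>b\<in>B - smooth P. b dvd n}"
  proof
    fix n assume "n \<in> prods (A \<inter> smooth P) (rough P)"
    then obtain u v where "u \<in> A" "u \<in> smooth P" "v \<in> rough P" "n = u * v"
      by (auto elim: prodsE)
    then show "n \<in> A \<union> {n. \<exists>b\<in>B - smooth P. b dvd n}"
      using smooth_part_mem_iff[of v P u] by auto
  qed
  then have "density_quotient (prods (A \<inter> smooth P) (rough P)) x \<le>
      density_quotient (A \<union> {n. \<exists>b\<in>B - smooth P. b dvd n}) x"
    by (intro density_quotient_mono[OF assms(2)]) auto
  also have "\<dots> \<le> density_quotient A x + density_quotient {n. \<exists>b\<in>B - smooth P. b dvd n} x"
    by (rule density_quotient_Un_le[OF assms(2)])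
  also have "density_quotient {n. \<exists>b\<in>B - smooth P. b dvd n} x \<le> hsum (B - smooth P)"
    using B_pos assms by (intro density_quotient_multiples_le hsummable_subset[OF assms(1)]) auto
  finally show ?thesis
    by simp
qed

lemma dens_smooth_part_mem:
  assumes "finite P" "\<And>p. p \<in> P \<Longrightarrow> prime p"
  shows "dens (prods (A \<inter> smooth P) (rough P)) (1 / hsum (B \<inter> smooth P))"
proof -
  obtain \<rho> where \<rho>: "\<rho> > 0" "dens (rough P) \<rho>"
    using dens_rough[OF assms] by auto
  have sm: "hsummable (smooth P)"
    using assms by (rule hsummable_smooth)
  have "hsum (smooth P) = hsum (A \<inter> smooth P) * hsum (B \<inter> smooth P)"
    using hsum_prods[OF unique_prods_subset[OF unique, of "A \<inter> smooth P" "B \<inter> smooth P"]]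
      hsummable_subset[OF sm] sm by (simp add: prods_smooth)
  with dens_rough_hsum_smooth[OF assms \<rho>(2)]
  have "\<rho> * hsum (A \<inter> smooth P) * hsum (B \<inter> smooth P) = 1"
    by simp
  then have "\<rho> * hsum (A \<inter> smooth P) = 1 / hsum (B \<inter> smooth P)"
    \<comment> \<open>The product being 1 makes the divisor nonzero.\<close>
    by (metis eq_divide_eq mult_zero_right zero_neq_one)
  then show ?thesis
    using dens_prods_rough[OF assms \<rho>(2), of "A \<inter> smooth P"] by simp
qed

text \<open>Take all primes up to some \<open>N\<close> bounding both \<open>F\<close> and
  \<open>M\<close>: every number from 1 to \<open>N\<close> is then smooth, so the non-smooth
  elements of \<open>B\<close> exceed \<open>N\<close>.\<close>

lemma exhaust_smooth:
  assumes "finite F" "F \<subseteq> {1..}"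
  obtains P where "finite P" "\<And>p. p \<in> P \<Longrightarrow> prime p" "F \<subseteq> smooth P"
    "\<And>b. b \<in> B - smooth P \<Longrightarrow> M \<le> real b"
proof -
  obtain N where N: "\<And>n. n \<in> F \<Longrightarrow> n \<le> N" "M \<le> real N"
  proof -
    obtain k where k: "\<And>n. n \<in> F \<Longrightarrow> n \<le> k"
      using assms(1) by (metis Max_ge)
    show ?thesis
      by (rule that[of "max k (nat \<lceil>M\<rceil>)"]) (use k in \<open>auto simp: le_max_iff_disj, linarith\<close>)
  qed
  define P where "P = {p. prime p \<and> p \<le> N}"
  have small: "n \<in> smooth P" if "n \<ge> 1" "n \<le> N" for n
    using that by (auto simp: smooth_def P_def dest: dvd_imp_le)
  show ?thesis
  proof (rule that[of P])
    show "F \<subseteq> smooth P"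
      using small N assms(2) by auto
    show "M \<le> real b" if "b \<in> B - smooth P" for b
      using small[of b] that B_pos N(2) by (cases "b \<le> N") auto
  qed (auto simp: P_def)
qed

text \<open>Half of \<open>e\<close> pays for convergence, the other half is \<open>1 / M\<close>
  with \<open>M = 2 / e\<close>. A finite \<open>F\<close> in place of \<open>B\<close> lets the
  bound serve both cases of the harmonic sum; \<open>F \<noteq> {}\<close> keeps the denominator
  positive.\<close>

lemma eventually_density_quotient_less:
  assumes "finite F" "F \<subseteq> B" "F \<noteq> {}" "e > 0"
  shows "\<forall>\<^sub>F x in at_top. density_quotient A x < 1 / (\<Sum>b\<in>F. 1 / real b) + e"
proof -
  obtain P where P: "finite P" "\<And>p. p \<in> P \<Longrightarrow> prime p" "F \<subseteq> smooth P"
    "\<And>b. b \<in> B - smooth P \<Longrightarrow> 2 / e \<le> real b"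
    by (rule exhaust_smooth[OF assms(1) order_trans[OF assms(2) B_pos], where M = "2 / e"]) blast
  have "(\<Sum>b\<in>F. 1 / real b) \<le> hsum (B \<inter> smooth P)"
    using assms(1,2) P(3) hsummable_subset[OF hsummable_smooth[OF P(1,2)]]
    by (intro finite_sum_le_infsum) auto
  moreover have "0 < (\<Sum>b\<in>F. 1 / real b)"
    using assms(1-3) B_pos by (intro sum_pos) (auto simp: Suc_le_eq)
  ultimately have "1 / hsum (B \<inter> smooth P) < 1 / (\<Sum>b\<in>F. 1 / real b) + e / 2"
    using assms(4) by (smt (verit) frac_le half_gt_zero)
  with dens_smooth_part_mem[OF P(1,2)]
  have "\<forall>\<^sub>F x in at_top. density_quotient (prods (A \<inter> smooth P) (rough P)) x <
      1 / (\<Sum>b\<in>F. 1 / real b) + e / 2"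
    by (rule order_tendstoD)
  then show ?thesis
    using eventually_gt_at_top[of 0]
  proof eventually_elim
    case (elim x)
    then show ?case
      using density_quotient_upper[of P "2 / e" x, OF P(2,4)] assms(4) by simp
  qed
qed

text \<open>The limit \<open>1 / hsum (B \<inter> smooth P)\<close> is at least
  \<open>1 / hsum B\<close>, and the comparison with \<open>A\<close> costs only the tail of
  \<open>B\<close>.\<close>

lemma eventually_density_quotient_greater:
  assumes "hsummable B" "e > 0"
  shows "\<forall>\<^sub>F x in at_top. 1 / hsum B - e < density_quotient A x"
proof -
  obtain F where F: "finite F" "F \<subseteq> B" "hsum (B - F) < e / 2"
    by (rule hsum_approx[OF assms(1) half_gt_zero[OF assms(2)]])
  \<comment> \<open>The tail is controlled through \<open>F\<close>, so the size bound is left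
    trivial with \<open>M = 0\<close>.\<close>
  obtain P where P: "finite P" "\<And>p. p \<in> P \<Longrightarrow> prime p" "F \<subseteq> smooth P"
    by (rule exhaust_smooth[OF F(1) order_trans[OF F(2) B_pos], where M = 0]) blast
  have tail: "hsum (B - smooth P) < e / 2"
    using hsum_mono[OF hsummable_subset[OF assms(1), of "B - F"] Diff_mono[OF order_refl P(3)]] F(3)
    by simp
  \<comment> \<open>The element 1 keeps the denominator positive when reciprocals are
    compared.\<close>
  have "1 \<le> hsum (B \<inter> smooth P)"
    using finite_sum_le_infsum[of "\<lambda>s. 1 / real s" "B \<inter> smooth P" "{1}"] one_mem one_smooth[of P]
      hsummable_subset[OF assms(1)] by simp
  then have "1 / hsum B - e / 2 < 1 / hsum (B \<inter> smooth P)"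
    using hsum_mono[OF assms(1), of "B \<inter> smooth P"] assms(2) by (smt (verit) Int_lower1 frac_le half_gt_zero)
  with dens_smooth_part_mem[OF P(1,2)]
  have "\<forall>\<^sub>F x in at_top. 1 / hsum B - e / 2 < density_quotient (prods (A \<inter> smooth P) (rough P)) x"
    by (rule order_tendstoD)
  then show ?thesis
    using eventually_gt_at_top[of 0]
  proof eventually_elim
    case (elim x)
    then show ?case
      using density_quotient_lower[OF assms(1), of x P] tail by simp
  qed
qed

lemma dens_factor_infinite:
  assumes "harmonic_sum B = \<infinity>"
  shows "dens A 0"
proof (rule tendstoI)
  fix e :: real assume "e > 0"
  have "ennreal (2 / e) < harmonic_sum B"
    using assms by simp
  then obtain F where F: "finite F" "F \<subseteq> B" "ennreal (2 / e) < ennreal (\<Sum>b\<in>F. 1 / real b)"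
    unfolding harmonic_sum_SUP less_SUP_iff by auto
  then have "2 / e < (\<Sum>b\<in>F. 1 / real b)"
    using \<open>e > 0\<close> by (simp add: ennreal_less_iff)
  moreover from this have "0 < (\<Sum>b\<in>F. 1 / real b)"
    using \<open>e > 0\<close> by (smt (verit) divide_pos_pos)
  ultimately have small: "1 / (\<Sum>b\<in>F. 1 / real b) < e / 2" and "F \<noteq> {}"
    using \<open>e > 0\<close> by (auto simp: pos_divide_less_eq mult.commute)
  with eventually_density_quotient_less[OF F(1,2) _ half_gt_zero[OF \<open>e > 0\<close>]]
  have "\<forall>\<^sub>F x in at_top. density_quotient A x < 1 / (\<Sum>b\<in>F. 1 / real b) + e / 2"
    by simp
  then show "\<forall>\<^sub>F x in at_top. dist (density_quotient A x) 0 < e"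
    using eventually_gt_at_top[of 0]
  proof eventually_elim
    case (elim x)
    then have "0 \<le> density_quotient A x"
      by (simp add: density_quotient_def)
    then show ?case
      using elim small by simp
  qed
qed

lemma dens_factor_finite:
  assumes "harmonic_sum B \<noteq> \<infinity>"
  shows "dens A (inverse (enn2real (harmonic_sum B)))"
proof -
  have sB: "hsummable B"
    using assms by (rule hsummable_if_finite)
  have "enn2real (harmonic_sum B) = hsum B"
    by (simp add: harmonic_sum_eq_hsum[OF sB] infsum_nonneg)
  moreover have "dens A (1 / hsum B)"
  proof (rule order_tendstoI)
    fix c assume "c < 1 / hsum B"
    then show "\<forall>\<^sub>F x in at_top. c < density_quotient A x"
      using eventually_density_quotient_greater[OF sB, of "1 / hsum B - c"] by simp
  next
    fix c assume c: "1 / hsum B < c"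
    have one: "1 \<le> hsum B"
      using finite_sum_le_infsum[of "\<lambda>s. 1 / real s" B "{1}"] one_mem sB by simp
    \<comment> \<open>Reciprocals of finite partial sums converge to \<open>1 / hsum B\<close>,
      which provides a finite set already below \<open>c\<close>.\<close>
    have "((\<lambda>F. 1 / (\<Sum>b\<in>F. 1 / real b)) \<longlongrightarrow> 1 / hsum B) (finite_subsets_at_top B)"
      using has_sum_infsum[OF sB] one unfolding has_sum_def by (intro tendsto_divide) auto
    then have "\<forall>\<^sub>F F in finite_subsets_at_top B. 1 / (\<Sum>b\<in>F. 1 / real b) < c"
      using c by (rule order_tendstoD)
    then obtain F0 where F0: "finite F0" "F0 \<subseteq> B"
      "\<forall>F. finite F \<and> F0 \<subseteq> F \<and> F \<subseteq> B \<longrightarrow> 1 / (\<Sum>b\<in>F. 1 / real b) < c"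
      unfolding eventually_finite_subsets_at_top by blast
    \<comment> \<open>Adding 1 makes the set nonempty, and the bound persists for all finite
      supersets of \<open>F0\<close> in \<open>B\<close>.\<close>
    define F where "F = insert 1 F0"
    have F: "finite F" "F \<subseteq> B" "F \<noteq> {}" and "F0 \<subseteq> F"
      using F0(1,2) one_mem by (auto simp: F_def)
    then have F_less: "1 / (\<Sum>b\<in>F. 1 / real b) < c"
      using F0(3) by blast
    show "\<forall>\<^sub>F x in at_top. density_quotient A x < c"
      using eventually_density_quotient_less[OF F, of "c - 1 / (\<Sum>b\<in>F. 1 / real b)"] F_less
      by simp
  qed
  ultimately show ?thesis
    by (simp add: inverse_eq_divide)
qed

end

subsection \<open>Families of direct factors\<close>

lemma prod_fun_upd_insert:
  assumes "finite J" "j \<notin> J"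
  shows "(\<Prod>k\<in>insert j J. (c(j := z)) k) = z * (\<Prod>k\<in>J. c k :: nat)"
proof -
  have "(\<Prod>k\<in>J. (c(j := z)) k) = (\<Prod>k\<in>J. c k)"
    using assms(2) by (intro prod.cong) auto
  then show ?thesis
    unfolding prod.insert[OF assms] by simp
qed

lemma prods_PiE_insert:
  assumes "finite J" "j \<notin> J"
  shows "(\<lambda>a. \<Prod>k\<in>insert j J. a k) ` (Pi\<^sub>E (insert j J) A) = prods (A j) ((\<lambda>a. \<Prod>k\<in>J. a k) ` (Pi\<^sub>E J A))"
proof -
  have "(\<lambda>a. \<Prod>k\<in>insert j J. a k) ` (Pi\<^sub>E (insert j J) A) =
      (\<lambda>(z, c). z * (\<Prod>k\<in>J. c k)) ` (A j \<times> Pi\<^sub>E J A)"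
    unfolding PiE_insert_eq image_image case_prod_unfold prod_fun_upd_insert[OF assms] ..
  also have "\<dots> = prods (A j) ((\<lambda>a. \<Prod>k\<in>J. a k) ` (Pi\<^sub>E J A))"
    unfolding prods_def by (simp add: image_paired_Times[of "\<lambda>x. x", symmetric, simplified] image_image case_prod_unfold)
  finally show ?thesis .
qed

text \<open>Updating at \<open>j\<close> turns a pair into a tuple over \<open>insert j J\<close>
  with the same product, so injectivity there applies.\<close>

lemma unique_prods_PiE_insert:
  assumes "finite J" "j \<notin> J" "inj_on (\<lambda>a. \<Prod>k\<in>insert j J. a k) (Pi\<^sub>E (insert j J) A)"
  shows "unique_prods (A j) ((\<lambda>a. \<Prod>k\<in>J. a k) ` (Pi\<^sub>E J A))"
proof (rule inj_onI, clarify)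
  fix x y a b
  assume *: "x \<in> A j" "y \<in> A j" "a \<in> Pi\<^sub>E J A" "b \<in> Pi\<^sub>E J A" "x * (\<Prod>k\<in>J. a k) = y * (\<Prod>k\<in>J. b k)"
  have "a(j := x) = b(j := y)"
  proof (rule inj_onD[OF assms(3)])
    show "(\<Prod>k\<in>insert j J. (a(j := x)) k) = (\<Prod>k\<in>insert j J. (b(j := y)) k)"
      unfolding prod_fun_upd_insert[OF assms(1,2)] by (rule *(5))
  qed (intro PiE_fun_upd *)+
  then have "x = y" and eq: "\<And>k. k \<noteq> j \<Longrightarrow> a k = b k"
    by (metis fun_upd_apply)+
  moreover have "(\<Prod>k\<in>J. a k) = (\<Prod>k\<in>J. b k)"
  proof (rule prod.cong[OF refl])
    show "a k = b k" if "k \<in> J" for k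
      using that assms(2) by (intro eq) blast
  qed
  ultimately show "x = y \<and> (\<Prod>k\<in>J. a k) = (\<Prod>k\<in>J. b k)"
    by blast
qed

text \<open>One factor is split off at a time. Injectivity is assumed for all subsets so that it
  passes to the smaller index set; the empty product gives the set containing only 1.\<close>

lemma harmonic_sum_PiE:
  assumes "finite J" "\<And>K. K \<subseteq> J \<Longrightarrow> inj_on (\<lambda>a. \<Prod>k\<in>K. a k) (Pi\<^sub>E K A)"
  shows "harmonic_sum ((\<lambda>a. \<Prod>k\<in>J. a k) ` (Pi\<^sub>E J A)) = (\<Prod>j\<in>J. harmonic_sum (A j))"
  using assms
proof (induction J rule: finite_induct)
  case empty
  show ?case
    by (simp add: harmonic_sum_def)
next
  case (insert j J)
  have IH: "harmonic_sum ((\<lambda>a. \<Prod>k\<in>J. a k) ` (Pi\<^sub>E J A)) = (\<Prod>j\<in>J. harmonic_sum (A j))"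
    by (rule insert.IH) (use insert.prems in auto)
  have "unique_prods (A j) ((\<lambda>a. \<Prod>k\<in>J. a k) ` (Pi\<^sub>E J A))"
    using insert.hyps insert.prems[OF order_refl] by (rule unique_prods_PiE_insert)
  then show ?case
    unfolding prods_PiE_insert[OF insert.hyps] unfolding prod.insert[OF insert.hyps] IH[symmetric]
    by (rule harmonic_sum_prods)
qed

context
  fixes m :: nat and A :: "nat \<Rightarrow> nat set"
  assumes df: "direct_factors m A"
begin

lemma direct_factors_one_mem: "i \<in> {1..m} \<Longrightarrow> 1 \<in> A i"
proof -
  assume i: "i \<in> {1..m}"
  obtain a where a: "a \<in> (\<Pi>\<^sub>E i\<in>{1..m}. A i)" "1 = (\<Prod>i=1..m. a i)"
    using df unfolding direct_factors_def by (metis order_refl)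
  then have "a i = 1"
    using i by (metis finite_atLeastAtMost prod_eq_1_iff)
  then show ?thesis
    using a(1) i by (metis PiE_mem)
qed

lemma direct_factors_pos: "i \<in> {1..m} \<Longrightarrow> A i \<subseteq> {1..}"
  using df unfolding direct_factors_def by blast

text \<open>Each \<open>A i\<close> contains 1, so tuples over \<open>J\<close> extend by 1 to full
  tuples with the same product, which are unique.\<close>

lemma direct_factors_inj:
  assumes "J \<subseteq> {1..m}"
  shows "inj_on (\<lambda>a. \<Prod>j\<in>J. a j) (Pi\<^sub>E J A)"
proof (rule inj_onI)
  fix a b assume ab: "a \<in> Pi\<^sub>E J A" "b \<in> Pi\<^sub>E J A" "(\<Prod>j\<in>J. a j) = (\<Prod>j\<in>J. b j)"
  define ext where "ext c = (\<lambda>k\<in>{1..m}. if k \<in> J then c k else 1)" for c :: "nat \<Rightarrow> nat"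
  have mem: "ext c \<in> Pi\<^sub>E {1..m} A" if "c \<in> Pi\<^sub>E J A" for c
    using that direct_factors_one_mem by (auto simp: ext_def PiE_mem)
  have prod_ext: "(\<Prod>k=1..m. ext c k) = (\<Prod>j\<in>J. c j)" for c
    by (rule prod.mono_neutral_cong_right) (use assms in \<open>auto simp: ext_def\<close>)
  \<comment> \<open>Uniqueness of the tuple is available only for products that are at least
    1.\<close>
  have "(\<Prod>j\<in>J. a j) \<ge> 1"
    using ab(1) direct_factors_pos assms by (intro prod_ge_1) (meson PiE_mem atLeast_iff subsetD)
  then have "ext a = ext b"
    using df mem[OF ab(1)] mem[OF ab(2)] prod_ext[of a] prod_ext[of b] ab(3)
    unfolding direct_factors_def by metis
  then have "a k = b k" if "k \<in> J" for k
    using that assms by (auto simp: ext_def dest!: fun_cong[of _ _ k])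
  then show "a = b"
    using ab by (intro PiE_ext) auto
qed

lemma direct_factors_factor_pair:
  assumes i: "i \<in> {1..m}"
  shows "factor_pair (A i) ((\<lambda>a. \<Prod>j\<in>{1..m} - {i}. a j) ` (Pi\<^sub>E ({1..m} - {i}) A))"
proof -
  have ins: "insert i ({1..m} - {i}) = {1..m}"
    using i by auto
  have pos: "(\<Prod>j\<in>J. a j) \<ge> 1" if "a \<in> Pi\<^sub>E J A" "J \<subseteq> {1..m}" for a J
    using that direct_factors_pos by (intro prod_ge_1) (meson PiE_mem atLeast_iff subsetD)
  show ?thesis
  proof
    show "unique_prods (A i) ((\<lambda>a. \<Prod>j\<in>{1..m} - {i}. a j) ` (Pi\<^sub>E ({1..m} - {i}) A))"
      by (rule unique_prods_PiE_insert) (simp_all only: ins direct_factors_inj order_refl, auto)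
    have "prods (A i) ((\<lambda>a. \<Prod>j\<in>{1..m} - {i}. a j) ` (Pi\<^sub>E ({1..m} - {i}) A)) =
        (\<lambda>a. \<Prod>j\<in>{1..m}. a j) ` (Pi\<^sub>E {1..m} A)"
      using prods_PiE_insert[of "{1..m} - {i}" i A] unfolding ins by simp
    also have "\<dots> = {1..}"
    proof (intro equalityI subsetI)
      fix n :: nat assume "n \<in> {1..}"
      then obtain a where "a \<in> (\<Pi>\<^sub>E i\<in>{1..m}. A i)" "n = (\<Prod>i=1..m. a i)"
        using df unfolding direct_factors_def by (metis atLeast_iff)
      then show "n \<in> (\<lambda>a. \<Prod>j\<in>{1..m}. a j) ` (Pi\<^sub>E {1..m} A)"
        by blast
    qed (use pos in auto)
    finally show "prods (A i) ((\<lambda>a. \<Prod>j\<in>{1..m} - {i}. a j) ` (Pi\<^sub>E ({1..m} - {i}) A)) = {1..}" .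
  qed (use direct_factors_pos[OF i] pos in auto)
qed

lemma harmonic_sum_complementary_factor:
  "harmonic_sum ((\<lambda>a. \<Prod>j\<in>{1..m} - {i}. a j) ` (Pi\<^sub>E ({1..m} - {i}) A)) =
    (\<Prod>j\<in>{1..m} - {i}. harmonic_sum (A j))"
  by (intro harmonic_sum_PiE direct_factors_inj) auto

text \<open>Excludes the case \<open>0 * \<infinity> = 0\<close> in \<open>ennreal\<close>, so a
  product of these sums is infinite exactly when one of them is.\<close>

lemma harmonic_sum_direct_factor_nonzero:
  assumes "i \<in> {1..m}"
  shows "harmonic_sum (A i) \<noteq> 0"
  using sum_le_harmonic_sum[of "{1}" "A i"] direct_factors_one_mem[OF assms] by auto

end

lemma natural_density_eqI:
  assumes "dens S d"
  shows "has_natural_density S \<and> natural_density S = d"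
  unfolding has_natural_density_def natural_density_def
  using assms tendsto_Lim[OF trivial_limit_at_top_linorder assms] by blast

lemma enn2real_prod: "enn2real (\<Prod>i\<in>I. f i) = (\<Prod>i\<in>I. enn2real (f i))"
  by (induction I rule: infinite_finite_induct) (simp_all add: enn2real_mult)

theorem theorem2:
  fixes m :: nat and A :: "nat \<Rightarrow> nat set"
  assumes "m \<ge> 2"
    and "direct_factors m A"
  shows "\<forall>i\<in>{1..m}.
           has_natural_density (A i) \<and>
           natural_density (A i) =
             (if \<exists>j\<in>{1..m} - {i}. harmonic_sum (A j) = \<infinity> then 0
              else \<Prod>j\<in>{1..m} - {i}. inverse (enn2real (harmonic_sum (A j))))"
proof
  fix i assume i: "i \<in> {1..m}"
  let ?J = "{1..m} - {i}"
  let ?B = "(\<lambda>a. \<Prod>j\<in>?J. a j) ` (Pi\<^sub>E ?J A)"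
  interpret factor_pair "A i" ?B
    by (rule direct_factors_factor_pair[OF assms(2) i])
  note HB = harmonic_sum_complementary_factor[OF assms(2), of i]
  have inf_iff: "harmonic_sum ?B = \<infinity> \<longleftrightarrow> (\<exists>j\<in>?J. harmonic_sum (A j) = \<infinity>)"
    unfolding HB using harmonic_sum_direct_factor_nonzero[OF assms(2)]
    by (auto simp: ennreal_prod_eq_top)
  have "dens (A i) (if \<exists>j\<in>?J. harmonic_sum (A j) = \<infinity> then 0
      else \<Prod>j\<in>?J. inverse (enn2real (harmonic_sum (A j))))"
  proof (cases "harmonic_sum ?B = \<infinity>")
    case True
    then show ?thesis
      using dens_factor_infinite inf_iff by simp
  next
    case False
    \<comment> \<open>All factors are finite in this branch, so \<open>enn2real\<close> returns
      their true values.\<close>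
    have "inverse (enn2real (harmonic_sum ?B)) = (\<Prod>j\<in>?J. inverse (enn2real (harmonic_sum (A j))))"
      unfolding HB enn2real_prod by (rule prod_inversef[symmetric, unfolded comp_def])
    with dens_factor_finite[OF False] show ?thesis
      using False inf_iff by simp
  qed
  then show "has_natural_density (A i) \<and> natural_density (A i) =
      (if \<exists>j\<in>?J. harmonic_sum (A j) = \<infinity> then 0
       else \<Prod>j\<in>?J. inverse (enn2real (harmonic_sum (A j))))"
    by (rule natural_density_eqI)
qed

end
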